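(* Let $V$ be an $L_1$ component. Suppose the compiler ${\downarrow}^2_3$ is correct with respect to the $L_2$ component ${\downarrow}^1_2V$ and behaviors are invertible. Then for every $L_2$ context $A$, $A\in\mathsf{Exploit}^1_2(V)$ implies ${\downarrow}^2_3A\in\mathsf{Exploit}^1_3(V)$.
   Context: There are three languages $L_1,L_2,L_3$. Each $L_i$ has whole programs, components, contexts, and a set of behaviors $\mathcal{B}^i$. Linking a context $C$ with a component $U$ of the same language gives a whole program $C[U]$ (assumed always well-defined). Each whole program $P$ of $L_i$ has a behavior $B(P)\in\mathcal{B}^i$. There are compilers ${\downarrow}^1_2$ (from $L_1$ to $L_2$) and ${\downarrow}^2_3$ (from $L_2$ to $L_3$), each mapping whole programs, components and contexts to whole programs, components and contexts respectively, and each modular: $B({\downarrow}(C[U]))=B({\downarrow}C[{\downarrow}U])$. Their composite (first ${\downarrow}^1_2$, then ${\downarrow}^2_3$) is ${\downarrow}^1_3$. Arbitrary relations $\mapsto^1_2\subseteq\mathcal{B}^1\times\mathcal{B}^2$ and $\mapsto^2_3\subseteq\mathcal{B}^2\times\mathcal{B}^3$ are given, and $b^1\mapsto^1_3b^3$ means that there exists $b^2\in\mathcal{B}^2$ with $b^1\mapsto^1_2b^2$ and $b^2\mapsto^2_3b^3$. Attacker sets $\mathcal{A}_2$ of $L_2$ contexts and $\mathcal{A}_3$ of $L_3$ contexts are fixed, with ${\downarrow}^2_3A\in\mathcal{A}_3$ for all $A\in\mathcal{A}_2$. For $j\in\{2,3\}$ and an $L_1$ component $V$, $$\mathsf{Exploit}^1_j(V)=\{A\in\mathcal{A}_j\mid\text{there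 is no } L_1 \text{ context } C \text{ with } B(C[V])\mapsto^1_jB(A[{\downarrow}^1_jV])\}.$$ The compiler ${\downarrow}^i_j$ is correct with respect to an $L_i$ component $U$ if $B(C[U])\mapsto^i_jB({\downarrow}^i_jC[{\downarrow}^i_jU])$ for every $L_i$ context $C$. Behaviors are invertible if for all $b^1,b^3$: $b^1\mapsto^1_3b^3$ implies that for all $b^2\in\mathcal{B}^2$, $b^2\mapsto^2_3b^3\iff b^1\mapsto^1_2b^2$. *)

theory Defs
  imports Main
begin

text \<open>The whole programs, components, contexts and behaviors of a language are the types
  \<open>'p\<close>, \<open>'u\<close>, \<open>'c\<close> and \<open>'b\<close>. Linking is a total function.\<close>

record ('p, 'u, 'c, 'b) language =
  link :: "'c \<Rightarrow> 'u \<Rightarrow> 'p"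
  behavior :: "'p \<Rightarrow> 'b"

record ('p, 'u, 'c, 'q, 'v, 'd) compiler =
  comp_prog :: "'p \<Rightarrow> 'q"
  comp_component :: "'u \<Rightarrow> 'v"
  comp_ctx :: "'c \<Rightarrow> 'd"

definition modular ::
  "('p, 'u, 'c, 'b) language \<Rightarrow> ('q, 'v, 'd, 'e) language
    \<Rightarrow> ('p, 'u, 'c, 'q, 'v, 'd) compiler \<Rightarrow> bool" where
  "modular L L' K \<longleftrightarrow>
    (\<forall>C U. behavior L' (comp_prog K (link L C U))
         = behavior L' (link L' (comp_ctx K C) (comp_component K U)))"

text \<open>The composite that applies \<open>K\<close> first and \<open>K'\<close> second.\<close>

definition compiler_seq ::
  "('p, 'u, 'c, 'q, 'v, 'd) compiler \<Rightarrow> ('q, 'v, 'd, 'r, 'w, 'f) compiler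
    \<Rightarrow> ('p, 'u, 'c, 'r, 'w, 'f) compiler" where
  "compiler_seq K K' =
    \<lparr> comp_prog = comp_prog K' \<circ> comp_prog K,
      comp_component = comp_component K' \<circ> comp_component K,
      comp_ctx = comp_ctx K' \<circ> comp_ctx K \<rparr>"

definition Exploit ::
  "('p, 'u, 'c, 'b) language \<Rightarrow> ('q, 'v, 'd, 'e) language
    \<Rightarrow> ('p, 'u, 'c, 'q, 'v, 'd) compiler \<Rightarrow> ('b \<times> 'e) set \<Rightarrow> 'd set \<Rightarrow> 'u \<Rightarrow> 'd set" where
  "Exploit L L' K R Att V =
    {A \<in> Att. \<not> (\<exists>C. (behavior L (link L C V),
                       behavior L' (link L' A (comp_component K V))) \<in> R)}"

definition correct_wrt ::
  "('p, 'u, 'c, 'b) language \<Rightarrow> ('q, 'v, 'd, 'e) language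
    \<Rightarrow> ('p, 'u, 'c, 'q, 'v, 'd) compiler \<Rightarrow> ('b \<times> 'e) set \<Rightarrow> 'u \<Rightarrow> bool" where
  "correct_wrt L L' K R U \<longleftrightarrow>
    (\<forall>C. (behavior L (link L C U),
          behavior L' (link L' (comp_ctx K C) (comp_component K U))) \<in> R)"

text \<open>The relational composition \<open>R O S\<close> relates \<open>b1\<close> to \<open>b3\<close> iff
  \<open>(b1, b2) \<in> R\<close> and \<open>(b2, b3) \<in> S\<close> for some \<open>b2\<close>.\<close>

definition behaviors_invertible :: "('b1 \<times> 'b2) set \<Rightarrow> ('b2 \<times> 'b3) set \<Rightarrow> bool" where
  "behaviors_invertible R S \<longleftrightarrow>
    (\<forall>b1 b3. (b1, b3) \<in> R O S \<longrightarrow> (\<forall>b2. (b2, b3) \<in> S \<longleftrightarrow> (b1, b2) \<in> R))"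

end

theory Submission
  imports Defs
begin

text \<open>Argue by contradiction: let a source context \<open>C\<close> account for the compiled
  attack, so \<open>C[V]\<close> is related to its behavior \<open>b3\<close> by
  \<open>R12 O R23\<close>. Correctness at the context \<open>A\<close> relates the behavior
  \<open>b2\<close> of the uncompiled attack to the same \<open>b3\<close>. Invertibility then
  relates \<open>C[V]\<close> to \<open>b2\<close> by \<open>R12\<close>, so \<open>C\<close>
  already accounts for \<open>A\<close>, which is impossible for an exploit.\<close>

theorem mainTheorem7:
  fixes L1 :: "('p1, 'u1, 'c1, 'b1) language"
    and L2 :: "('p2, 'u2, 'c2, 'b2) language"
    and L3 :: "('p3, 'u3, 'c3, 'b3) language"
    and K12 :: "('p1, 'u1, 'c1, 'p2, 'u2, 'c2) compiler"
    and K23 :: "('p2, 'u2, 'c2, 'p3, 'u3, 'c3) compiler"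
    and R12 :: "('b1 \<times> 'b2) set"
    and R23 :: "('b2 \<times> 'b3) set"
    and A2 :: "'c2 set"
    and A3 :: "'c3 set"
    and V :: 'u1
  assumes "modular L1 L2 K12"
    and "modular L2 L3 K23"
    and "\<forall>A\<in>A2. comp_ctx K23 A \<in> A3"
    and "correct_wrt L2 L3 K23 R23 (comp_component K12 V)"
    and "behaviors_invertible R12 R23"
  shows "\<forall>A. A \<in> Exploit L1 L2 K12 R12 A2 V \<longrightarrow>
    comp_ctx K23 A \<in> Exploit L1 L3 (compiler_seq K12 K23) (R12 O R23) A3 V"
proof (intro allI impI)
  fix A
  assume A: "A \<in> Exploit L1 L2 K12 R12 A2 V"
  let ?b1 = "\<lambda>C. behavior L1 (link L1 C V)"
  let ?b2 = "behavior L2 (link L2 A (comp_component K12 V))"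
  \<comment> \<open>The composite compiler is written out here, so that \<open>?b3\<close> fits both
    correctness of \<open>K23\<close> and the unfolded goal.\<close>
  let ?b3 = "behavior L3 (link L3 (comp_ctx K23 A) (comp_component K23 (comp_component K12 V)))"
  have S: "(?b2, ?b3) \<in> R23"
    using assms(4) by (simp add: correct_wrt_def)
  have "(?b1 C, ?b3) \<notin> R12 O R23" for C
  proof
    assume "(?b1 C, ?b3) \<in> R12 O R23"
    \<comment> \<open>The intermediate behavior hidden in \<open>R12 O R23\<close> may differ from
      \<open>?b2\<close>; invertibility speaks of every intermediate behavior and so can be used at
      \<open>?b2\<close>.\<close>
    with assms(5) have "(?b2, ?b3) \<in> R23 \<longleftrightarrow> (?b1 C, ?b2) \<in> R12"
      unfolding behaviors_invertible_def by blast
    with S A show False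
      by (auto simp: Exploit_def)
  qed
  moreover have "comp_ctx K23 A \<in> A3"
    using A assms(3) by (simp add: Exploit_def)
  ultimately show "comp_ctx K23 A \<in> Exploit L1 L3 (compiler_seq K12 K23) (R12 O R23) A3 V"
    by (simp add: Exploit_def compiler_seq_def)
qed

end
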